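(* Suppose $M$ is a direct sum of cyclic monoids. Then exactly one of the following holds: (1) $M$ is a cyclic monoid, in which case it has no covering by proper sub-monoids. (2) $M$ is an abelian group but not a cyclic monoid. In this case, let $S$ be the set of primes $p \in \mathbb{Z}$ for which $\dim_{\mathbb{Z}/p\mathbb{Z}} M/pM \geq 2$. Then either $S$ is empty and $\sigma(M) = |\mathbb{Z}|$; or $S$ is nonempty, in which case $3 \leq \sigma(M) < \infty$ and $\sigma(M) = \nu'(\mathbb{Z},M) := \min_{p \in S} (p+1)$. (3) $M$ is neither a cyclic monoid nor an abelian group, and $\sigma(M) = 2$.
   Context: A cyclic monoid is a monoid generated (as a monoid) by a single element. A direct sum of cyclic monoids $(M_k)_{k}$, over an index set of arbitrary cardinality, is the (commutative) monoid of all tuples in $\prod_k M_k$ with all but finitely many entries equal to the identity. Here $\sigma(M)$ denotes the covering number of $M$ as a monoid: the smallest cardinal $\aleph$ (possibly infinite) such that $M$ is a union of $\aleph$-many proper sub-monoids. *)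

theory Defs
  imports
    "HOL-Algebra.Product_Groups"
    "HOL-Number_Theory.Residues"
    "Jordan_Normal_Form.Missing_VectorSpace"
begin

unbundle cardinal_syntax

section \<open>Direct sums of cyclic monoids\<close>

definition generated_submonoid :: "('a, 'b) monoid_scheme \<Rightarrow> 'a set \<Rightarrow> 'a set"
  where "generated_submonoid M A = \<Inter>{H. submonoid H M \<and> A \<subseteq> H}"

definition cyclic_monoid :: "('a, 'b) monoid_scheme \<Rightarrow> bool"
  where "cyclic_monoid M \<longleftrightarrow>
    monoid M \<and> (\<exists>a\<in>carrier M. carrier M = generated_submonoid M {a})"

text \<open>The library's \<^const>\<open>product_group\<close> makes sense for arbitrary monoids. Its
  \<^const>\<open>sum_group\<close> does not: it is built from group generation, which mentions inverses.\<close>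

definition direct_sum_monoid :: "'i set \<Rightarrow> ('i \<Rightarrow> ('a, 'b) monoid_scheme) \<Rightarrow> ('i \<Rightarrow> 'a) monoid"
  where "direct_sum_monoid I K = (product_group I K)
    \<lparr>carrier := {x \<in> carrier (product_group I K). finite {i \<in> I. x i \<noteq> \<one>\<^bsub>K i\<^esub>}}\<rparr>"

section \<open>The covering number\<close>

definition submonoid_covering :: "('a, 'b) monoid_scheme \<Rightarrow> 'a set set \<Rightarrow> bool"
  where "submonoid_covering M \<C> \<longleftrightarrow>
    (\<forall>H\<in>\<C>. submonoid H M \<and> H \<noteq> carrier M) \<and> \<Union>\<C> = carrier M"

definition coverable :: "('a, 'b) monoid_scheme \<Rightarrow> bool"
  where "coverable M \<longleftrightarrow> (\<exists>\<C>. submonoid_covering M \<C>)"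

text \<open>A cardinal is represented, up to \<^term>\<open>(=o)\<close>, by a cardinal well-order. The value is
  meaningful only for coverable monoids; see \<open>covering_number_least\<close> below.\<close>

definition covering_number :: "('a, 'b) monoid_scheme \<Rightarrow> 'a set rel"
  where "covering_number M = |SOME \<C>. submonoid_covering M \<C> \<and>
    (\<forall>\<D>. submonoid_covering M \<D> \<longrightarrow> |\<C>| \<le>o |\<D>| )|"

lemma covering_number_least:
  assumes "coverable M"
  shows "\<exists>\<C>. submonoid_covering M \<C> \<and> covering_number M = |\<C>|"
    and "submonoid_covering M \<D> \<Longrightarrow> covering_number M \<le>o |\<D>|"
proof -
  let ?P = "\<lambda>\<C>. submonoid_covering M \<C> \<and> (\<forall>\<D>. submonoid_covering M \<D> \<longrightarrow> |\<C>| \<le>o |\<D>| )"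
  let ?R = "card_of ` {\<C>. submonoid_covering M \<C>}"
  have "?R \<noteq> {}" "\<forall>r\<in>?R. Card_order r"
    using assms by (auto simp: coverable_def card_of_Card_order)
  from exists_minim_Card_order[OF this]
  obtain r where "r \<in> ?R" "\<forall>r'\<in>?R. r \<le>o r'" by blast
  then have "\<exists>\<C>. ?P \<C>" by auto
  then have *: "?P (SOME \<C>. ?P \<C>)" by (rule someI_ex)
  show "\<exists>\<C>. submonoid_covering M \<C> \<and> covering_number M = |\<C>|"
    using * unfolding covering_number_def by blast
  show "submonoid_covering M \<D> \<Longrightarrow> covering_number M \<le>o |\<D>|"
    using * unfolding covering_number_def by blast
qed

section \<open>The vector spaces \<open>M/pM\<close>\<close>

definition multiples :: "('a, 'b) monoid_scheme \<Rightarrow> nat \<Rightarrow> 'a set"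
  where "multiples M n = (\<lambda>x. x [^]\<^bsub>M\<^esub> n) ` carrier M"

text \<open>For a multiplicatively written abelian group \<open>M\<close>, the quotient \<open>M/pM\<close> in additive
  notation, with \<open>k\<close> in \<open>{0..p-1}\<close> acting as the \<open>k\<close>-th multiple. The ring multiplication and
  unit, which module records carry but modules never use, are dummies.\<close>

definition quotient_space :: "('a, 'b) monoid_scheme \<Rightarrow> nat \<Rightarrow> (int, 'a set) module"
  where "quotient_space M p = (let Q = M Mod multiples M p in
    \<lparr>carrier = carrier Q, monoid.mult = (\<lambda>X Y. \<one>\<^bsub>Q\<^esub>), one = \<one>\<^bsub>Q\<^esub>,
     zero = \<one>\<^bsub>Q\<^esub>, add = (\<otimes>\<^bsub>Q\<^esub>), smult = (\<lambda>k X. X [^]\<^bsub>Q\<^esub> k)\<rparr>)"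

lemma (in comm_group) multiples_subgroup: "subgroup (multiples G n) G"
proof
  show "multiples G n \<subseteq> carrier G" by (auto simp: multiples_def)
  show "\<one> \<in> multiples G n"
    unfolding multiples_def by (rule image_eqI[of _ _ "\<one>"]) auto
  fix x assume "x \<in> multiples G n"
  then obtain a where a: "a \<in> carrier G" "x = a [^] n" by (auto simp: multiples_def)
  then show "inv x \<in> multiples G n"
    unfolding multiples_def by (intro image_eqI[of _ _ "inv a"]) (auto simp: nat_pow_inv)
  fix y assume "y \<in> multiples G n"
  then obtain b where b: "b \<in> carrier G" "y = b [^] n" by (auto simp: multiples_def)
  with a show "x \<otimes> y \<in> multiples G n"
    unfolding multiples_def
    by (intro image_eqI[of _ _ "a \<otimes> b"]) (auto simp: nat_pow_distrib)
qed

lemma (in comm_group) quotient_space_vectorspace: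
  assumes "Factorial_Ring.prime p"
  shows "vectorspace (residue_ring (int p)) (quotient_space G p)"
proof -
  let ?N = "multiples G p" and ?R = "residue_ring (int p)" and ?V = "quotient_space G p"
  interpret R: residues_prime p ?R
    using assms by unfold_locales simp_all
  interpret N: subgroup ?N G by (rule multiples_subgroup)
  interpret Q: comm_group "G Mod ?N"
    by (rule abelian_FactGroup[OF multiples_subgroup])
  have normal: "?N \<lhd> G"
    by (simp add: multiples_subgroup subgroup_imp_normal)
  have kill: "X [^]\<^bsub>G Mod ?N\<^esub> int p = \<one>\<^bsub>G Mod ?N\<^esub>" if X: "X \<in> carrier (G Mod ?N)" for X
  proof -
    obtain a where a: "a \<in> carrier G" "X = ?N #> a"
      using X by (auto simp: FactGroup_def RCOSETS_def)
    have "X [^]\<^bsub>G Mod ?N\<^esub> p = ?N #> (a [^] p)"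
      using a normal.FactGroup_pow[OF normal] by simp
    also have "\<dots> = ?N"
      using a by (intro coset_join2 multiples_subgroup) (auto simp: multiples_def)
    finally show ?thesis by (simp add: int_pow_int)
  qed
  have red: "X [^]\<^bsub>G Mod ?N\<^esub> (k mod int p) = X [^]\<^bsub>G Mod ?N\<^esub> k"
    if X: "X \<in> carrier (G Mod ?N)" for X and k :: int
  proof -
    have "X [^]\<^bsub>G Mod ?N\<^esub> k = X [^]\<^bsub>G Mod ?N\<^esub> (int p * (k div int p) + k mod int p)"
      by simp
    also have "\<dots> = (X [^]\<^bsub>G Mod ?N\<^esub> int p) [^]\<^bsub>G Mod ?N\<^esub> (k div int p)
        \<otimes>\<^bsub>G Mod ?N\<^esub> X [^]\<^bsub>G Mod ?N\<^esub> (k mod int p)"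
      using X by (simp only: Q.int_pow_mult Q.int_pow_pow)
    also have "\<dots> = X [^]\<^bsub>G Mod ?N\<^esub> (k mod int p)"
      using X by (simp only: kill Q.int_pow_one Q.l_one Q.int_pow_closed)
    finally show ?thesis by simp
  qed
  have "module ?R ?V"
  proof (rule moduleI)
    show "cring ?R" by (rule R.cring)
    show "abelian_group ?V"
      by (rule abelian_groupI)
         (simp_all add: quotient_space_def Let_def Q.m_ac Q.l_inv_ex
           del: mult_FactGroup one_FactGroup)
  qed (auto simp: quotient_space_def Let_def residue_ring_def red Q.int_pow_mult Q.int_pow_pow
        Q.int_pow_distrib mult.commute Q.int_pow_closed simp del: mult_FactGroup one_FactGroup)
  then show ?thesis
    by (simp add: vectorspace_def R.is_field)
qed

text \<open>The library's \<open>dim\<close> is a natural number, meaningful only for finite-dimensional spaces;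
  infinite-dimensional ones also have dimension at least \<open>2\<close>.\<close>

definition rank_primes :: "('a, 'b) monoid_scheme \<Rightarrow> nat set"
  where "rank_primes M = {p. Factorial_Ring.prime p \<and>
    (vectorspace.fin_dim (residue_ring (int p)) (quotient_space M p) \<longrightarrow>
      2 \<le> vectorspace.dim (residue_ring (int p)) (quotient_space M p))}"

text \<open>Infinite sets of primes are possible, so the minimum is not taken with \<^const>\<open>Min\<close>. The
  value is meaningful only if there is such a prime.\<close>

definition nu_prime :: "('a, 'b) monoid_scheme \<Rightarrow> nat"
  where "nu_prime M = (LEAST n. \<exists>p\<in>rank_primes M. n = p + 1)"

end

theory Submission
  imports Defs
begin

text \<open>A cyclic monoid has no covering, because the member of a covering that contains a generator is
everything. Suppose from now on that \<open>M\<close> is a direct sum of cyclic monoids and not cyclic.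

If \<open>M\<close> is not a group, then some summand has a generator none of whose positive powers is
\<open>\<one>\<close>. In such a summand a product is trivial only if both factors are, so the elements of \<open>M\<close>
with trivial coordinate there form a submonoid, and so do the elements with nontrivial coordinate
together with \<open>\<one>\<close>. Both are proper, as \<open>M\<close> has another nontrivial summand
(\<open>covered_by_two\<close>), and a single proper submonoid never suffices; hence the covering number is \<open>2\<close>.

If \<open>M\<close> is a group, then its summands are finite cyclic groups, \<open>M\<close> is a torsion group, and its
submonoids are subgroups. The lower bound holds in every torsion abelian group: a covering by \<open>n\<close>
proper subgroups yields a prime \<open>p < n\<close> whose primary part is not cyclic
(\<open>finite_covering_bound\<close>). Indeed each member misses an element of some primary part; elements of
different primary parts can be glued to one element of which they are powers, so some primary part
\<open>M\<^sub>p\<close> is covered by those members that do not contain it; and if \<open>x\<close> lies in just one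
member \<open>H\<close> of a minimal such covering and \<open>y\<close> lies outside \<open>H\<close>, then the \<open>p\<close> elements
\<open>x\<^sup>k y\<close> with \<open>k < p\<close> lie in \<open>p\<close> distinct further members.

For direct sums of finite cyclic groups the primes whose primary part is not cyclic are the primes
with \<open>dim M/pM \<ge> 2\<close> (\<open>rank_prime_dichotomy\<close>). If \<open>p\<close> divides the orders of two summands, then
these summands give two independent homomorphisms \<open>f, g\<close> to \<open>\<int>/p\<int>\<close>. So \<open>dim M/pM \<ge> 2\<close>, and
the \<open>p + 1\<close> lines through the origin of the plane pull back to a covering of \<open>M\<close> by
\<open>p + 1\<close> proper subgroups. If \<open>p\<close> divides the order of at most one summand, then every element
is the product of a power of the generator of that summand and an element of order prime to \<open>p\<close>,
so that \<open>M\<^sub>p\<close> is cyclic and \<open>dim M/pM \<le> 1\<close>.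

Hence the least such prime \<open>p\<close>, if there is one, gives the covering number \<open>p + 1\<close>. If there
is none, then there is no finite covering, and the countably many subgroups of elements killed by
\<open>n\<close>, for \<open>n > 0\<close>, cover \<open>M\<close>. They are proper, because a group of bounded exponent
with cyclic primary parts is cyclic (\<open>cyclic_if_bounded_exponent\<close>).\<close>

section \<open>Cyclic monoids\<close>

lemma (in monoid) submonoid_powers:
  assumes "a \<in> carrier G"
  shows "submonoid (range (\<lambda>n::nat. a [^] n)) G"
  using assms by unfold_locales (auto simp: nat_pow_mult intro: image_eqI[of _ _ 0])

lemma (in monoid) generated_submonoid_singleton:
  assumes a: "a \<in> carrier G"
  shows "generated_submonoid G {a} = range (\<lambda>n::nat. a [^] n)"
proof
  note submonoid_powers[OF a]
  moreover have "a \<in> range (\<lambda>n::nat. a [^] n)"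
    using a by (intro image_eqI[of _ _ 1]) auto
  ultimately show "generated_submonoid G {a} \<subseteq> range (\<lambda>n::nat. a [^] n)"
    by (auto simp: generated_submonoid_def)
  have "a [^] n \<in> H" if "submonoid H G" "a \<in> H" for H and n :: nat
    using that by (induction n) (auto simp: submonoid_def)
  then show "range (\<lambda>n::nat. a [^] n) \<subseteq> generated_submonoid G {a}"
    by (auto simp: generated_submonoid_def)
qed

lemma cyclic_monoid_iff:
  "cyclic_monoid M \<longleftrightarrow>
    monoid M \<and> (\<exists>a\<in>carrier M. \<forall>x\<in>carrier M. \<exists>n::nat. x = a [^]\<^bsub>M\<^esub> n)"
proof -
  have "carrier M = generated_submonoid M {a} \<longleftrightarrow> (\<forall>x\<in>carrier M. \<exists>n::nat. x = a [^]\<^bsub>M\<^esub> n)"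
    if "monoid M" "a \<in> carrier M" for a
    using that by (auto simp: monoid.generated_submonoid_singleton monoid.nat_pow_closed)
  then show ?thesis unfolding cyclic_monoid_def by blast
qed

lemma cyclic_monoid_not_coverable:
  assumes "cyclic_monoid M"
  shows "\<not> coverable M"
proof
  obtain a where a: "a \<in> carrier M" "carrier M = generated_submonoid M {a}"
    using assms by (auto simp: cyclic_monoid_def)
  assume "coverable M"
  then obtain C where C: "submonoid_covering M C" by (auto simp: coverable_def)
  with a(1) obtain H where H: "H \<in> C" "a \<in> H" by (auto simp: submonoid_covering_def)
  with C have "submonoid H M" "H \<noteq> carrier M" by (auto simp: submonoid_covering_def)
  moreover from this(1) have "carrier M \<subseteq> H"
    using H a by (auto simp: generated_submonoid_def)
  ultimately show False by (auto simp: submonoid_def)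
qed

section \<open>Primary parts of torsion groups\<close>

lemma (in monoid) pow_eq_pow_if_cong:
  fixes m :: nat
  assumes "x \<in> carrier G" "x [^] m = \<one>" "[a = b] (mod m)"
  shows "x [^] a = x [^] b"
proof -
  have "x [^] c = x [^] (c mod m)" for c :: nat
  proof -
    have "x [^] c = x [^] (m * (c div m) + c mod m)" by simp
    also have "\<dots> = (x [^] m) [^] (c div m) \<otimes> x [^] (c mod m)"
      using assms(1) by (simp only: nat_pow_mult nat_pow_pow)
    finally show ?thesis using assms by simp
  qed
  then show ?thesis
    using assms(3) by (metis cong_def)
qed

lemma (in group) pow_gcd_mem:
  fixes m n :: nat
  assumes "subgroup H G" "x \<in> carrier G" "x [^] m \<in> H" "x [^] n \<in> H"
  shows "x [^] gcd m n \<in> H"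
proof -
  obtain u v where uv: "u * int m + v * int n = gcd (int m) (int n)"
    using bezout_int by blast
  have "x [^] (gcd (int m) (int n)) = (x [^] int m) [^] u \<otimes> (x [^] int n) [^] v"
    unfolding uv[symmetric] using assms(2) by (simp add: int_pow_mult int_pow_pow mult.commute)
  moreover have "\<dots> \<in> H"
    using assms by (simp add: int_pow_int subgroup.m_closed subgroup_int_pow_closed)
  ultimately have "x [^] int (gcd m n) \<in> H"
    by (simp only: gcd_int_int_eq)
  then show ?thesis by (simp only: int_pow_int)
qed

lemma (in comm_group) subgroup_nat_pow_mem:
  assumes "subgroup H G" "x \<in> H"
  shows "x [^] (n::nat) \<in> H"
  using assms by (induction n) (auto simp: subgroup.one_closed subgroup.m_closed)

lemma (in group) submonoid_is_subgroup:
  assumes torsion: "\<And>x. x \<in> carrier G \<Longrightarrow> 0 < ord x" and H: "submonoid H G"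
  shows "subgroup H G"
proof
  show "H \<subseteq> carrier G" "\<one> \<in> H" "\<And>x y. x \<in> H \<Longrightarrow> y \<in> H \<Longrightarrow> x \<otimes> y \<in> H"
    using H by (auto simp: submonoid_def)
  fix x assume xH: "x \<in> H"
  then have x: "x \<in> carrier G" using H by (auto simp: submonoid_def)
  have pow: "x [^] n \<in> H" for n :: nat
    using xH H by (induction n) (auto simp: submonoid_def)
  have "x [^] (ord x - 1) \<otimes> x = x [^] (Suc (ord x - 1))" by simp
  also have "\<dots> = \<one>" using torsion[OF x] x by simp
  finally have "inv x = x [^] (ord x - 1)"
    using x by (metis inv_equality nat_pow_closed)
  then show "inv x \<in> H" using pow by simp
qed

definition primary_part :: "('a, 'b) monoid_scheme \<Rightarrow> nat \<Rightarrow> 'a set"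
  where "primary_part G p = {x \<in> carrier G. \<exists>k. x [^]\<^bsub>G\<^esub> (p ^ k) = \<one>\<^bsub>G\<^esub>}"

definition primary_part_cyclic :: "('a, 'b) monoid_scheme \<Rightarrow> nat \<Rightarrow> bool"
  where "primary_part_cyclic G p \<longleftrightarrow>
    (\<exists>g\<in>primary_part G p. \<forall>x\<in>primary_part G p. \<exists>k::nat. x = g [^]\<^bsub>G\<^esub> k)"

lemma (in comm_group) subgroup_primary_part: "subgroup (primary_part G p) G"
proof
  show "primary_part G p \<subseteq> carrier G" by (auto simp: primary_part_def)
  show "\<one> \<in> primary_part G p" by (auto simp: primary_part_def)
  fix x assume "x \<in> primary_part G p"
  then obtain k where x: "x \<in> carrier G" "x [^] (p ^ k) = \<one>" by (auto simp: primary_part_def)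
  show "inv x \<in> primary_part G p"
    using x by (auto simp: primary_part_def nat_pow_inv intro!: exI[of _ k])
  fix y assume "y \<in> primary_part G p"
  then obtain l where y: "y \<in> carrier G" "y [^] (p ^ l) = \<one>" by (auto simp: primary_part_def)
  have "x [^] (p ^ (k + l)) = \<one>" "y [^] (p ^ (k + l)) = \<one>"
    using x y by (simp_all add: pow_eq_id power_add)
  then show "x \<otimes> y \<in> primary_part G p"
    using x y by (auto simp: primary_part_def nat_pow_distrib intro!: exI[of _ "k + l"])
qed

text \<open>An element is a product of powers of itself that have prime power order. The proof avoids writing
down the factors: the exponents \<open>m\<close> with \<open>x\<^sup>m \<in> H\<close> are the multiples of the least
positive one, and no prime can divide that one.\<close>

lemma (in group) mem_if_primary_powers_mem:
  assumes H: "subgroup H G" and x: "x \<in> carrier G" "0 < ord x"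
    and mem: "\<And>p k::nat. Factorial_Ring.prime p \<Longrightarrow> p dvd ord x \<Longrightarrow> x [^] k \<in> primary_part G p \<Longrightarrow> x [^] k \<in> H"
  shows "x \<in> H"
proof -
  define d where "d = (LEAST d::nat. 0 < d \<and> x [^] d \<in> H)"
  have "0 < ord x \<and> x [^] ord x \<in> H"
    using H x by (simp add: subgroup.one_closed)
  then have d: "0 < d \<and> x [^] d \<in> H"
    unfolding d_def by (rule LeastI[of "\<lambda>d. 0 < d \<and> x [^] d \<in> H"])
  have dvd: "d dvd m" if "x [^] m \<in> H" for m
  proof -
    have "x [^] gcd d m \<in> H"
      using pow_gcd_mem[OF H x(1)] d that by blast
    then have "d \<le> gcd d m"
      unfolding d_def by (intro Least_le) (use d d_def in auto)
    then show ?thesis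
      using d by (metis dvd_imp_le gcd_dvd1 gcd_dvd2 le_antisym)
  qed
  show ?thesis
  proof (cases "d = 1")
    case True
    then show ?thesis using d x by simp
  next
    case False
    then obtain p where p: "Factorial_Ring.prime p" "p dvd d"
      using prime_factor_nat by blast
    have "d dvd ord x"
      by (rule dvd) (use H x in \<open>simp add: subgroup.one_closed\<close>)
    have "\<not> is_unit p" using p by auto
    \<comment> \<open>the exponent that removes everything but the \<open>p\<close>-part of the order\<close>
    then obtain c where c: "ord x = p ^ multiplicity p (ord x) * c" "\<not> p dvd c"
      using multiplicity_decompose'[of "ord x" p] x by auto
    have "(x [^] c) [^] (p ^ multiplicity p (ord x)) = \<one>"
      using x c by (simp add: nat_pow_pow mult.commute)
    then have "x [^] c \<in> primary_part G p"
      using x by (auto simp: primary_part_def)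
    with p \<open>d dvd ord x\<close> have "x [^] c \<in> H"
      by (intro mem[of p]) auto
    then have "p dvd c"
      using dvd p by (meson dvd_trans)
    with c show ?thesis by blast
  qed
qed

lemma (in comm_group) coprime_factor_is_power:
  fixes m n :: nat
  assumes "x \<in> carrier G" "y \<in> carrier G" "x [^] m = \<one>" "y [^] n = \<one>" "coprime m n"
  shows "\<exists>k::nat. x = (x \<otimes> y) [^] k"
proof -
  obtain e where e: "[n * e = 1] (mod m)"
    using cong_solve_coprime_nat[of n m] assms(5) by (auto simp: coprime_commute)
  have "(x \<otimes> y) [^] (n * e) = x [^] (n * e) \<otimes> (y [^] n) [^] e"
    using assms(1,2) by (simp only: nat_pow_distrib nat_pow_pow m_closed)
  also have "\<dots> = x [^] (1::nat)"
    using assms pow_eq_pow_if_cong[OF assms(1,3) e] by simp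
  finally show ?thesis
    using assms by (metis nat_pow_eone)
qed

text \<open>Elements of different primary parts are all powers of their product, by
\<open>coprime_factor_is_power\<close>. This glues choices made separately in the primary parts: a subgroup
that contains the glued element contains all of them.\<close>

lemma (in comm_group) simultaneous_root:
  assumes "finite P" "\<And>p. p \<in> P \<Longrightarrow> Factorial_Ring.prime p"
    and "\<And>p. p \<in> P \<Longrightarrow> y p \<in> primary_part G p"
  shows "\<exists>z\<in>carrier G. \<forall>p\<in>P. \<exists>k::nat. y p = z [^] k"
proof -
  \<comment> \<open>The exponent \<open>N\<close>, with its prime divisors in \<open>P\<close>, makes each next order coprime to that of \<open>z\<close>.\<close>
  have "\<exists>z\<in>carrier G. (\<forall>p\<in>P. \<exists>k::nat. y p = z [^] k) \<and>
      (\<exists>N::nat. z [^] N = \<one> \<and> (\<forall>q. Factorial_Ring.prime q \<longrightarrow> q dvd N \<longrightarrow> q \<in> P))"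
    using assms
  proof (induction P)
    case empty
    show ?case by (intro bexI[of _ \<one>] conjI exI[of _ 1]) auto
  next
    case (insert q P)
    then obtain z N where z: "z \<in> carrier G" "\<forall>p\<in>P. \<exists>k::nat. y p = z [^] k" "z [^] N = \<one>"
      "\<forall>q. Factorial_Ring.prime q \<longrightarrow> q dvd N \<longrightarrow> q \<in> P" by auto
    obtain k where y: "y q \<in> carrier G" "y q [^] (q ^ k) = \<one>"
      using insert.prems(2)[of q] by (auto simp: primary_part_def)
    have q: "Factorial_Ring.prime q" using insert by simp
    then have "\<not> q dvd N" using z insert by blast
    with q have cop: "coprime N (q ^ k)"
      by (metis coprime_commute coprime_power_right_iff prime_imp_coprime)
    obtain r where r: "z = (z \<otimes> y q) [^] (r::nat)"
      using coprime_factor_is_power[OF z(1) y(1) z(3) y(2) cop] by blast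
    obtain s where s: "y q = (y q \<otimes> z) [^] (s::nat)"
      using coprime_factor_is_power[OF y(1) z(1) y(2) z(3)] cop by (auto simp: coprime_commute)
    have pow: "\<exists>k::nat. y p = (z \<otimes> y q) [^] k" if pP: "p \<in> insert q P" for p
    proof (cases "p = q")
      case True
      then show ?thesis using s m_comm[of z "y q"] y z by metis
    next
      case False
      then obtain l where "y p = z [^] (l::nat)" using z(2) pP by auto
      then have "y p = (z \<otimes> y q) [^] (r * l)"
        using r z y by (metis m_closed nat_pow_pow)
      then show ?thesis ..
    qed
    have "z [^] (N * q ^ k) = \<one>" "y q [^] (N * q ^ k) = \<one>"
      using y z by (simp_all add: pow_eq_id)
    then have "(z \<otimes> y q) [^] (N * q ^ k) = \<one>"
      using y z by (simp add: nat_pow_distrib)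
    moreover have "r \<in> insert q P" if "Factorial_Ring.prime r" "r dvd N * q ^ k" for r
      using that z q by (metis insert_iff prime_dvd_mult_iff prime_dvd_power primes_dvd_imp_eq)
    ultimately show ?case
      using pow y z by (intro bexI[of _ "z \<otimes> y q"] conjI exI[of _ "N * q ^ k"]) auto
  qed
  then show ?thesis by blast
qed

text \<open>Only the finitely many primes that divide the exponent contribute, so that generators of the
primary parts can be glued to a generator of the group.\<close>

lemma (in comm_group) cyclic_if_bounded_exponent:
  assumes n: "0 < n" "\<And>x. x \<in> carrier G \<Longrightarrow> x [^] (n::nat) = \<one>"
    and cyc: "\<And>p. Factorial_Ring.prime p \<Longrightarrow> primary_part_cyclic G p"
  shows "cyclic_monoid G"
proof -
  have dvd: "ord x dvd n" if "x \<in> carrier G" for x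
    using that n(2) by (simp add: pow_eq_id)
  have torsion: "0 < ord x" if "x \<in> carrier G" for x
    using dvd[OF that] n(1) by (auto intro: Nat.gr0I)
  have "\<exists>g\<in>primary_part G p. \<forall>x\<in>primary_part G p. \<exists>k::nat. x = g [^] k"
    if "Factorial_Ring.prime p" for p
    using cyc[OF that] by (simp add: primary_part_cyclic_def)
  then obtain g where g: "\<And>p. Factorial_Ring.prime p \<Longrightarrow> g p \<in> primary_part G p"
    "\<And>p x. Factorial_Ring.prime p \<Longrightarrow> x \<in> primary_part G p \<Longrightarrow> \<exists>k::nat. x = g p [^] k"
    by metis
  have "finite {p. Factorial_Ring.prime p \<and> p dvd n}"
    using n by simp
  from simultaneous_root[OF this, of g] g(1) obtain z where z: "z \<in> carrier G"
    "\<And>p. Factorial_Ring.prime p \<Longrightarrow> p dvd n \<Longrightarrow> \<exists>k::nat. g p = z [^] k"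
    by auto
  define H where "H = range (\<lambda>k::nat. z [^] k)"
  have H: "subgroup H G"
    unfolding H_def by (intro submonoid_is_subgroup torsion submonoid_powers z)
  have "x \<in> H" if x: "x \<in> carrier G" for x
  proof (rule mem_if_primary_powers_mem[OF H x torsion[OF x]])
    fix p k :: nat
    assume p: "Factorial_Ring.prime p" "p dvd ord x" "x [^] k \<in> primary_part G p"
    obtain l where "g p = z [^] (l::nat)" using z(2) p dvd[OF x] dvd_trans by blast
    then have "g p \<in> H" by (auto simp: H_def)
    then show "x [^] k \<in> H"
      using g(2)[OF p(1,3)] subgroup_nat_pow_mem[OF H] by auto
  qed
  then show ?thesis
    using z(1) monoid_axioms unfolding cyclic_monoid_iff H_def by blast
qed

section \<open>A lower bound for finite coverings\<close>

text \<open>Choose elements of the primary part: \<open>x\<close> in only one member \<open>H\<close> of a minimal subcovering, and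
\<open>y\<close> outside \<open>H\<close>. The elements
\<open>x\<^sup>k y\<close> with \<open>k < p\<close> avoid \<open>H\<close>. No two of them lie in the same member, for then that member
would contain some \<open>x\<^sup>d\<close> with \<open>0 < d < p\<close>, hence \<open>x\<close>, whose order is a power of \<open>p\<close>.\<close>

lemma (in comm_group) primary_part_covering_bound:
  assumes p: "Factorial_Ring.prime p" and D: "finite D" "\<And>H. H \<in> D \<Longrightarrow> subgroup H G"
    and proper: "\<And>H. H \<in> D \<Longrightarrow> \<not> primary_part G p \<subseteq> H"
    and cover: "primary_part G p \<subseteq> \<Union>D"
  shows "p + 1 \<le> card D"
proof -
  let ?P = "primary_part G p"
  interpret P: subgroup ?P G by (rule subgroup_primary_part)
  define n where "n = (LEAST n. \<exists>E\<subseteq>D. ?P \<subseteq> \<Union>E \<and> card E = n)"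
  have "\<exists>E\<subseteq>D. ?P \<subseteq> \<Union>E \<and> card E = n"
    unfolding n_def by (rule LeastI[of _ "card D"]) (use cover in blast)
  then obtain E where E: "E \<subseteq> D" "?P \<subseteq> \<Union>E" "card E = n" by blast
  have finE: "finite E" using E(1) D(1) finite_subset by blast
  have min: "\<not> ?P \<subseteq> \<Union>(E - {H})" if "H \<in> E" for H
  proof
    assume "?P \<subseteq> \<Union>(E - {H})"
    then have "n \<le> card (E - {H})"
      unfolding n_def using E(1) by (intro Least_le exI[of _ "E - {H}"] conjI) auto
    moreover have "card (E - {H}) < card E"
      using finE that by (rule card_Diff1_less)
    ultimately show False using E(3) by linarith
  qed
  obtain H where H: "H \<in> E" using E(2) P.one_closed by blast
  obtain x where x: "x \<in> ?P" "\<And>H'. H' \<in> E \<Longrightarrow> H' \<noteq> H \<Longrightarrow> x \<notin> H'"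
    using min[OF H] by blast
  then have xH: "x \<in> H" using E(2) by blast
  have HG: "subgroup H G" using H E D by blast
  obtain y where y: "y \<in> ?P" "y \<notin> H" using proper H E by blast
  have xy: "x \<in> carrier G" "y \<in> carrier G" using x y by auto
  have "\<exists>F\<in>E - {H}. x [^] k \<otimes> y \<in> F" for k :: nat
  proof -
    have "x [^] k \<otimes> y \<in> ?P"
      using x y by (simp add: subgroup_nat_pow_mem[OF subgroup_primary_part])
    moreover have "x [^] k \<otimes> y \<notin> H"
    proof
      assume "x [^] k \<otimes> y \<in> H"
      moreover have "inv (x [^] k) \<in> H"
        by (intro subgroup.m_inv_closed[OF HG] subgroup_nat_pow_mem[OF HG] xH)
      ultimately have "inv (x [^] k) \<otimes> (x [^] k \<otimes> y) \<in> H"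
        by (rule subgroup.m_closed[OF HG, rotated])
      then show False using xy y by (simp add: m_assoc[symmetric])
    qed
    ultimately show ?thesis using E(2) by auto
  qed
  then obtain F where F: "\<And>k::nat. F k \<in> E - {H}" "\<And>k. x [^] k \<otimes> y \<in> F k" by metis
  have neq: "F k \<noteq> F l" if "k < l" "l < p" for k l
  proof
    assume eq: "F k = F l"
    have FG: "subgroup (F l) G" using F(1)[of l] E D by blast
    have "(x [^] l \<otimes> y) \<otimes> inv (x [^] k \<otimes> y) \<in> F l"
      using F(2)[of l] F(2)[of k] eq by (metis FG subgroup.m_closed subgroup.m_inv_closed)
    moreover have "(x [^] l \<otimes> y) \<otimes> inv (x [^] k \<otimes> y) = x [^] (l - k)"
    proof -
      have "x [^] l = x [^] (l - k) \<otimes> x [^] k"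
        using that xy by (simp add: nat_pow_mult)
      then have "x [^] l \<otimes> y = x [^] (l - k) \<otimes> (x [^] k \<otimes> y)"
        using xy by (simp add: m_assoc)
      then show ?thesis using xy by (simp add: m_assoc)
    qed
    ultimately have pow: "x [^] (l - k) \<in> F l" by simp
    have "\<exists>r. x [^] (p ^ r) = \<one>" using x(1) unfolding primary_part_def by blast
    then obtain r where r: "x [^] (p ^ r) = \<one>" ..
    have "\<not> p dvd (l - k)" using that by (intro nat_dvd_not_less) auto
    then have "gcd (l - k) (p ^ r) = 1"
      using p by (metis coprime_commute coprime_imp_gcd_eq_1 coprime_power_right_iff prime_imp_coprime)
    moreover have "x [^] gcd (l - k) (p ^ r) \<in> F l"
      by (rule pow_gcd_mem[OF FG xy(1) pow]) (simp add: r subgroup.one_closed[OF FG])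
    ultimately have "x \<in> F l" using xy by simp
    then show False using x(2)[of "F l"] F(1)[of l] by blast
  qed
  have "inj_on F {..<p}"
    by (rule inj_onI) (metis neq lessThan_iff linorder_neqE_nat)
  then have "p \<le> card (E - {H})"
    using card_inj_on_le[of F "{..<p}" "E - {H}"] F(1) finE by auto
  moreover have "card (E - {H}) < card E" using finE H by (rule card_Diff1_less)
  moreover have "card E \<le> card D" using E(1) D(1) by (simp add: card_mono)
  ultimately show ?thesis by linarith
qed

text \<open>Assign to each \<open>H \<in> C\<close> a prime whose primary part is not contained in \<open>H\<close>. Some primary part is
covered by the members assigned to its own prime: otherwise choose in each of these primary parts
an element outside the members assigned to it, and glue the choices; the glued element lies in no
member of \<open>C\<close>.\<close>

theorem (in comm_group) finite_covering_bound:
  assumes torsion: "\<And>x. x \<in> carrier G \<Longrightarrow> 0 < ord x"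
    and C: "finite C" "\<And>H. H \<in> C \<Longrightarrow> subgroup H G \<and> H \<noteq> carrier G"
    and cover: "carrier G \<subseteq> \<Union>C"
  obtains p where "Factorial_Ring.prime p" "\<not> primary_part_cyclic G p" "p + 1 \<le> card C"
proof -
  have "\<exists>p. Factorial_Ring.prime p \<and> \<not> primary_part G p \<subseteq> H" if "H \<in> C" for H
  proof (rule ccontr)
    assume "\<nexists>p. Factorial_Ring.prime p \<and> \<not> primary_part G p \<subseteq> H"
    then have *: "primary_part G p \<subseteq> H" if "Factorial_Ring.prime p" for p
      using that by blast
    have HG: "subgroup H G" "H \<noteq> carrier G" using C(2) that by auto
    have "x \<in> H" if "x \<in> carrier G" for x
      by (rule mem_if_primary_powers_mem[OF HG(1) that torsion[OF that]]) (use * in auto)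
    then show False using HG subgroup.subset by blast
  qed
  then obtain p where p: "\<And>H. H \<in> C \<Longrightarrow> Factorial_Ring.prime (p H)"
    "\<And>H. H \<in> C \<Longrightarrow> \<not> primary_part G (p H) \<subseteq> H" by metis
  define D where "D q = {H \<in> C. p H = q}" for q
  obtain q where q: "q \<in> p ` C" "primary_part G q \<subseteq> \<Union>(D q)"
  proof (rule ccontr)
    assume "\<not> thesis"
    then have "\<forall>q\<in>p ` C. \<exists>y. y \<in> primary_part G q \<and> y \<notin> \<Union>(D q)" using that by blast
    then obtain y where y: "\<And>q. q \<in> p ` C \<Longrightarrow> y q \<in> primary_part G q"
      "\<And>q. q \<in> p ` C \<Longrightarrow> y q \<notin> \<Union>(D q)" by metis
    obtain z where z: "z \<in> carrier G" "\<And>q. q \<in> p ` C \<Longrightarrow> \<exists>k::nat. y q = z [^] k"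
      using simultaneous_root[OF finite_imageI[OF C(1)], of p y] p(1) y(1) by blast
    obtain H where H: "H \<in> C" "z \<in> H" using cover z by blast
    then have "y (p H) \<in> H" using z(2)[of "p H"] subgroup_nat_pow_mem[of H z] C by auto
    then show False using y(2)[of "p H"] H by (auto simp: D_def)
  qed
  have qp: "Factorial_Ring.prime q" using q(1) p by auto
  have "q + 1 \<le> card (D q)"
  proof (rule primary_part_covering_bound[OF qp _ _ _ q(2)])
    show "finite (D q)" "\<And>H. H \<in> D q \<Longrightarrow> subgroup H G"
      using C by (auto simp: D_def)
    show "\<not> primary_part G q \<subseteq> H" if "H \<in> D q" for H
      using p(2)[of H] that by (simp add: D_def)
  qed
  moreover have "card (D q) \<le> card C" using C by (auto simp: D_def intro: card_mono)
  moreover have "\<not> primary_part_cyclic G q"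
  proof
    assume "primary_part_cyclic G q"
    then obtain g where g: "g \<in> primary_part G q"
      "\<And>x. x \<in> primary_part G q \<Longrightarrow> \<exists>k::nat. x = g [^] k"
      by (auto simp: primary_part_cyclic_def)
    obtain H where H: "H \<in> D q" "g \<in> H" using g q by blast
    then have "primary_part G q \<subseteq> H"
      using g(2) subgroup_nat_pow_mem[of H g] C by (fastforce simp: D_def)
    then show False using p H by (auto simp: D_def)
  qed
  ultimately show ?thesis using that qp by fastforce
qed

section \<open>The dimension of \<open>M/pM\<close>\<close>

lemma (in vectorspace) fin_dim_dim_le_1_iff:
  "fin_dim \<and> dim \<le> 1 \<longleftrightarrow> (\<exists>w\<in>carrier V. \<forall>x\<in>carrier V. \<exists>k\<in>carrier K. x = k \<odot>\<^bsub>V\<^esub> w)"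
proof
  assume "fin_dim \<and> dim \<le> 1"
  then obtain B where B: "finite B" "basis B" "card B \<le> 1"
    using finite_basis_exists dim_basis by metis
  then have span: "span B = carrier V" and BV: "B \<subseteq> carrier V"
    by (auto simp: basis_def)
  from B consider "B = {}" | w where "B = {w}"
    by (metis card_1_singletonE card_0_eq le_less less_one)
  then show "\<exists>w\<in>carrier V. \<forall>x\<in>carrier V. \<exists>k\<in>carrier K. x = k \<odot>\<^bsub>V\<^esub> w"
  proof cases
    case 1
    then have "carrier V = {\<zero>\<^bsub>V\<^esub>}" using span span_empty by simp
    moreover have "\<zero>\<^bsub>V\<^esub> = \<one>\<^bsub>K\<^esub> \<odot>\<^bsub>V\<^esub> \<zero>\<^bsub>V\<^esub>" by simp
    ultimately show ?thesis by (metis R.one_closed singletonD singletonI)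
  next
    case 2
    have w: "w \<in> carrier V" using 2 BV by simp
    have "\<exists>k\<in>carrier K. x = k \<odot>\<^bsub>V\<^esub> w" if x: "x \<in> carrier V" for x
    proof -
      obtain a where a: "a \<in> {w} \<rightarrow> carrier K" "x = lincomb a {w}"
        using finite_in_span[of "{w}" x] x span 2 w by auto
      then show ?thesis
        using w by (auto simp: lincomb_def Pi_def intro!: bexI[of _ "a w"])
    qed
    with w show ?thesis by blast
  qed
next
  assume "\<exists>w\<in>carrier V. \<forall>x\<in>carrier V. \<exists>k\<in>carrier K. x = k \<odot>\<^bsub>V\<^esub> w"
  then obtain w where w: "w \<in> carrier V" "\<And>x. x \<in> carrier V \<Longrightarrow> \<exists>k\<in>carrier K. x = k \<odot>\<^bsub>V\<^esub> w"
    by blast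
  have "x \<in> span {w}" if x: "x \<in> carrier V" for x
  proof -
    obtain k where k: "k \<in> carrier K" "x = k \<odot>\<^bsub>V\<^esub> w" using w x by blast
    then have "x = lincomb (\<lambda>_. k) {w}" using w by (simp add: lincomb_def)
    then show ?thesis using k by (auto simp: span_def)
  qed
  then have "span {w} = carrier V"
    using w(1) span_closed[of "{w}"] by auto
  with w show "fin_dim \<and> dim \<le> 1"
    unfolding fin_dim_def by (intro conjI dim_le1I[of w] exI[of _ "{w}"]) auto
qed

text \<open>The existential statement says that the class of \<open>w\<close> generates \<open>G/pG\<close>. This reduces the later
arguments about the dimension to equations between elements of \<open>G\<close>.\<close>

lemma (in comm_group) rank_primes_iff:
  assumes p: "Factorial_Ring.prime p"
  shows "p \<in> rank_primes G \<longleftrightarrow>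
    \<not> (\<exists>w\<in>carrier G. \<forall>x\<in>carrier G. \<exists>k::nat. \<exists>y\<in>carrier G. x = w [^] k \<otimes> y [^] p)"
proof -
  let ?N = "multiples G p" and ?Q = "G Mod multiples G p"
  interpret V: vectorspace "residue_ring (int p)" "quotient_space G p"
    by (rule quotient_space_vectorspace[OF p])
  interpret N: subgroup ?N G by (rule multiples_subgroup)
  interpret N: normal ?N G by (simp add: multiples_subgroup subgroup_imp_normal)
  have p1: "1 < p" using p prime_gt_1_nat by blast
  have pow: "(?N #> w) [^]\<^bsub>?Q\<^esub> int k = ?N #> (w [^] k)" if "w \<in> carrier G" for w and k :: nat
    using that N.FactGroup_pow by (simp add: int_pow_int)
  have eq: "?N #> x = ?N #> (w [^] k) \<longleftrightarrow> (\<exists>y\<in>carrier G. x = w [^] k \<otimes> y [^] p)"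
    if "w \<in> carrier G" "x \<in> carrier G" for w x and k :: nat
  proof
    assume "?N #> x = ?N #> (w [^] k)"
    then have "x \<in> ?N #> (w [^] k)"
      using that by (metis multiples_subgroup rcos_self)
    then show "\<exists>y\<in>carrier G. x = w [^] k \<otimes> y [^] p"
      using that by (auto simp: r_coset_def multiples_def m_comm)
  next
    assume "\<exists>y\<in>carrier G. x = w [^] k \<otimes> y [^] p"
    then have "x \<in> ?N #> (w [^] k)"
      using that by (auto simp: r_coset_def multiples_def m_comm)
    then show "?N #> x = ?N #> (w [^] k)"
      using that by (metis multiples_subgroup nat_pow_closed repr_independence)
  qed
  have "(V.fin_dim \<and> V.dim \<le> 1) \<longleftrightarrow>
    (\<exists>w\<in>carrier G. \<forall>x\<in>carrier G. \<exists>k\<in>{0..int p - 1}. ?N #> x = (?N #> w) [^]\<^bsub>?Q\<^esub> k)"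
    unfolding V.fin_dim_dim_le_1_iff
    by (simp add: quotient_space_def Let_def carrier_FactGroup residue_ring_def)
  also have "\<dots> \<longleftrightarrow> (\<exists>w\<in>carrier G. \<forall>x\<in>carrier G. \<exists>k::nat. \<exists>y\<in>carrier G. x = w [^] k \<otimes> y [^] p)"
  proof (intro bex_cong ball_cong refl)
    fix w x assume w: "w \<in> carrier G" and x: "x \<in> carrier G"
    show "(\<exists>k\<in>{0..int p - 1}. ?N #> x = (?N #> w) [^]\<^bsub>?Q\<^esub> k) \<longleftrightarrow>
      (\<exists>k::nat. \<exists>y\<in>carrier G. x = w [^] k \<otimes> y [^] p)"
    proof
      assume "\<exists>k\<in>{0..int p - 1}. ?N #> x = (?N #> w) [^]\<^bsub>?Q\<^esub> k"
      then obtain k where k: "k \<ge> 0" "?N #> x = (?N #> w) [^]\<^bsub>?Q\<^esub> int (nat k)" by auto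
      then show "\<exists>k::nat. \<exists>y\<in>carrier G. x = w [^] k \<otimes> y [^] p"
        using w x pow eq by metis
    next
      assume "\<exists>k::nat. \<exists>y\<in>carrier G. x = w [^] k \<otimes> y [^] p"
      then obtain k :: nat and y where y: "y \<in> carrier G" "x = w [^] k \<otimes> y [^] p" by blast
      have "w [^] k = w [^] (k mod p) \<otimes> (w [^] (k div p)) [^] p"
        using w by (simp add: nat_pow_mult nat_pow_pow)
      then have "x = w [^] (k mod p) \<otimes> (w [^] (k div p) \<otimes> y) [^] p"
        using w y by (simp add: nat_pow_distrib m_assoc)
      then have "?N #> x = (?N #> w) [^]\<^bsub>?Q\<^esub> int (k mod p)"
        using eq[OF w x, of "k mod p"] pow[OF w] w y by auto
      then show "\<exists>k\<in>{0..int p - 1}. ?N #> x = (?N #> w) [^]\<^bsub>?Q\<^esub> k"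
        using p1 by (intro bexI[of _ "int (k mod p)"]) (auto simp: less_imp_le zle_diff1_eq)
    qed
  qed
  finally have "(V.fin_dim \<and> V.dim \<le> 1) \<longleftrightarrow>
    (\<exists>w\<in>carrier G. \<forall>x\<in>carrier G. \<exists>k::nat. \<exists>y\<in>carrier G. x = w [^] k \<otimes> y [^] p)" .
  moreover have "p \<in> rank_primes G \<longleftrightarrow> \<not> (V.fin_dim \<and> V.dim \<le> 1)"
  proof -
    have "\<not> d \<le> 1 \<longleftrightarrow> 2 \<le> d" for d :: nat by auto
    then show ?thesis using p by (simp add: rank_primes_def)
  qed
  ultimately show ?thesis by (simp only:)
qed

text \<open>The pair \<open>(f, g)\<close> is a homomorphism onto the plane over \<open>\<int>/p\<int>\<close>. It kills \<open>p\<close>-th powers, and a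
plane is not generated by one vector, so \<open>G/pG\<close> has dimension at least \<open>2\<close>. The plane is the union
of the \<open>p\<close> lines \<open>f = c g\<close> and the line \<open>g = 0\<close>, whose preimages form the covering.\<close>

lemma (in comm_group) two_characters:
  fixes f g :: "'a \<Rightarrow> int" and p :: nat
  assumes p: "Factorial_Ring.prime p"
    and f: "\<And>x y. x \<in> carrier G \<Longrightarrow> y \<in> carrier G \<Longrightarrow> [f (x \<otimes> y) = f x + f y] (mod int p)"
    and g: "\<And>x y. x \<in> carrier G \<Longrightarrow> y \<in> carrier G \<Longrightarrow> [g (x \<otimes> y) = g x + g y] (mod int p)"
    and u: "u \<in> carrier G" "[f u = 1] (mod int p)" "[g u = 0] (mod int p)"
    and v: "v \<in> carrier G" "[f v = 0] (mod int p)" "[g v = 1] (mod int p)"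
  shows two_characters_rank_prime: "p \<in> rank_primes G"
    and two_characters_covering: "\<exists>C. submonoid_covering G C \<and> finite C \<and> card C \<le> p + 1"
proof -
  have p1: "\<not> int p dvd 1" using p by auto
  have hom_one: "[h \<one> = 0] (mod int p)"
    if h: "\<And>x y. x \<in> carrier G \<Longrightarrow> y \<in> carrier G \<Longrightarrow> [h (x \<otimes> y) = h x + h y] (mod int p)" for h
    using h[of \<one> \<one>] by (simp add: cong_iff_dvd_diff)
  have hom_pow: "[h (x [^] n) = int n * h x] (mod int p)"
    if h: "\<And>x y. x \<in> carrier G \<Longrightarrow> y \<in> carrier G \<Longrightarrow> [h (x \<otimes> y) = h x + h y] (mod int p)"
      and x: "x \<in> carrier G" for h x and n :: nat
  proof (induction n)
    case 0
    show ?case using hom_one[OF h] by simp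
  next
    case (Suc n)
    have "[h (x [^] Suc n) = h (x [^] n) + h x] (mod int p)" using h x by simp
    also have "[h (x [^] n) + h x = int n * h x + h x] (mod int p)"
      by (intro cong_add Suc cong_refl)
    finally show ?case by (simp add: algebra_simps)
  qed
  have hom_mod: "[h (w [^] k \<otimes> y [^] p) = int k * h w] (mod int p)"
    if h: "\<And>x y. x \<in> carrier G \<Longrightarrow> y \<in> carrier G \<Longrightarrow> [h (x \<otimes> y) = h x + h y] (mod int p)"
      and wy: "w \<in> carrier G" "y \<in> carrier G" for h w y and k :: nat
  proof -
    have "[h (w [^] k \<otimes> y [^] p) = h (w [^] k) + h (y [^] p)] (mod int p)" using h wy by simp
    also have "[h (w [^] k) + h (y [^] p) = int k * h w + int p * h y] (mod int p)"
      by (intro cong_add hom_pow h wy)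
    also have "[int k * h w + int p * h y = int k * h w] (mod int p)"
      by (simp add: cong_iff_dvd_diff)
    finally show ?thesis .
  qed
  show "p \<in> rank_primes G"
    unfolding rank_primes_iff[OF p]
  proof
    assume "\<exists>w\<in>carrier G. \<forall>x\<in>carrier G. \<exists>k::nat. \<exists>y\<in>carrier G. x = w [^] k \<otimes> y [^] p"
    then obtain w where w: "w \<in> carrier G"
      "\<And>x. x \<in> carrier G \<Longrightarrow> \<exists>k::nat. \<exists>y\<in>carrier G. x = w [^] k \<otimes> y [^] p" by blast
    obtain k :: nat and y where k: "y \<in> carrier G" "u = w [^] k \<otimes> y [^] p"
      using w(2)[OF u(1)] by blast
    obtain l :: nat and z where l: "z \<in> carrier G" "v = w [^] l \<otimes> z [^] p"
      using w(2)[OF v(1)] by blast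
    have "[int k * f w = 1] (mod int p)" "[int k * g w = 0] (mod int p)" "[int l * g w = 1] (mod int p)"
      using hom_mod[OF f w(1) k(1), of k] hom_mod[OF g w(1) k(1), of k] hom_mod[OF g w(1) l(1), of l]
        u v k l by (metis cong_sym cong_trans)+
    then have 1: "int p dvd int k * f w - 1" "int p dvd int k * g w" "int p dvd int l * g w - 1"
      by (simp_all add: cong_iff_dvd_diff)
    \<comment> \<open>The images of \<open>u\<close> and \<open>v\<close> would be proportional, but their determinant is \<open>1\<close> modulo \<open>p\<close>.\<close>
    have "1 = int l * f w * (int k * g w) - (int k * f w - 1) * (int l * g w) - (int l * g w - 1)"
      by (simp add: algebra_simps)
    also have "int p dvd \<dots>" by (rule dvd_diff[OF dvd_diff[OF dvd_mult[OF 1(2)] dvd_mult2[OF 1(1)]] 1(3)])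
    finally show False using p1 by blast
  qed
  have sub: "submonoid {x \<in> carrier G. int p dvd a * f x + b * g x} G" for a b :: int
  proof
    have "int p dvd f \<one>" "int p dvd g \<one>"
      using hom_one[OF f] hom_one[OF g] by (simp_all add: cong_0_iff)
    then show "\<one> \<in> {x \<in> carrier G. int p dvd a * f x + b * g x}" by auto
    fix x y
    assume xy: "x \<in> {x \<in> carrier G. int p dvd a * f x + b * g x}"
      "y \<in> {x \<in> carrier G. int p dvd a * f x + b * g x}"
    then have "[a * f (x \<otimes> y) + b * g (x \<otimes> y) = a * (f x + f y) + b * (g x + g y)] (mod int p)"
      by (intro cong_add cong_mult cong_refl f g) auto
    moreover have "int p dvd a * (f x + f y) + b * (g x + g y)"
      using xy dvd_add[of "int p" "a * f x + b * g x" "a * f y + b * g y"] by (simp add: algebra_simps)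
    ultimately have "int p dvd a * f (x \<otimes> y) + b * g (x \<otimes> y)"
      by (simp add: cong_dvd_iff)
    then show "x \<otimes> y \<in> {x \<in> carrier G. int p dvd a * f x + b * g x}" using xy by simp
  qed auto
  let ?L = "\<lambda>c::nat. {x \<in> carrier G. int p dvd 1 * f x + - int c * g x}"
  let ?L' = "{x \<in> carrier G. int p dvd 0 * f x + 1 * g x}"
  let ?C = "insert ?L' (?L ` {..<p})"
  have "u \<notin> ?L c" for c
  proof
    assume "u \<in> ?L c"
    then have "int p dvd f u - int c * g u" by simp
    moreover have "[f u - int c * g u = 1 - int c * 0] (mod int p)"
      by (intro cong_diff cong_mult cong_refl u)
    ultimately show False using p1 cong_dvd_iff by fastforce
  qed
  moreover have "v \<notin> ?L'" using v(3) p1 cong_dvd_iff by fastforce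
  moreover have "\<Union>?C = carrier G"
  proof -
    have "x \<in> \<Union>?C" if x: "x \<in> carrier G" for x
    proof (cases "int p dvd g x")
      case True
      then show ?thesis using x by simp
    next
      case False
      then have "coprime (g x) (int p)"
        using p by (simp add: prime_imp_coprime coprime_commute)
      then obtain d where d: "[g x * d = 1] (mod int p)"
        using cong_solve_coprime_int by blast
      define c where "c = nat ((d * f x) mod int p)"
      have p0: "0 < int p" using p prime_gt_0_nat by simp
      have c: "int c = (d * f x) mod int p" "c < p"
        using p0 by (simp_all add: c_def nat_less_iff)
      have "[int c * g x = (d * f x) * g x] (mod int p)"
        unfolding c by (intro cong_mult cong_refl) (simp add: cong_def)
      also have "(d * f x) * g x = (g x * d) * f x" by simp
      also have "[\<dots> = 1 * f x] (mod int p)" by (intro cong_mult d cong_refl)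
      finally have "int p dvd f x - int c * g x"
        by (metis cong_iff_dvd_diff cong_sym mult_1)
      then have "x \<in> ?L c" using x by simp
      then show ?thesis using c(2) by blast
    qed
    then show ?thesis by auto
  qed
  ultimately have "submonoid_covering G ?C"
    unfolding submonoid_covering_def using sub u(1) v(1) by blast
  moreover have "card ?C \<le> p + 1"
    using card_insert_le_m1[of "p + 1" "?L ` {..<p}" ?L'] card_image_le[of "{..<p}" ?L] by simp
  ultimately show "\<exists>C. submonoid_covering G C \<and> finite C \<and> card C \<le> p + 1"
    by (intro exI[of _ ?C]) simp
qed

text \<open>Modulo elements of order prime to \<open>p\<close>, the group is generated by \<open>w\<close>. Such elements are \<open>p\<close>-th
powers, so the class of \<open>w\<close> generates \<open>G/pG\<close>. They are also removed by an exponent prime to \<open>p\<close>,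
and an element of the primary part is a power of each of its powers with such an exponent. So the
\<open>p\<close>-part of \<open>w\<close> generates the primary part.\<close>

lemma (in comm_group) cyclic_up_to_coprime_order:
  assumes p: "Factorial_Ring.prime p"
    and torsion: "\<And>x. x \<in> carrier G \<Longrightarrow> 0 < ord x"
    and w: "w \<in> carrier G"
    and decomp: "\<And>x. x \<in> carrier G \<Longrightarrow> \<exists>k::nat. \<exists>y\<in>carrier G. x = w [^] k \<otimes> y \<and> \<not> p dvd ord y"
  shows cyclic_up_to_coprime_order_primary: "primary_part_cyclic G p"
    and cyclic_up_to_coprime_order_rank: "p \<notin> rank_primes G"
proof -
  have root: "\<exists>e::nat. x = (x [^] n) [^] e" if x: "x \<in> carrier G" and n: "coprime n (ord x)" for x and n :: nat
  proof -
    obtain e where "[n * e = Suc 0] (mod ord x)"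
      using cong_solve_coprime_nat[OF n] by blast
    then have "x [^] (n * e) = x [^] Suc 0"
      using x by (intro pow_eq_pow_if_cong[of _ "ord x"]) auto
    then show ?thesis using x by (auto simp: nat_pow_pow intro!: exI[of _ e])
  qed
  have "\<exists>w\<in>carrier G. \<forall>x\<in>carrier G. \<exists>k::nat. \<exists>y\<in>carrier G. x = w [^] k \<otimes> y [^] p"
  proof (intro bexI[OF _ w] ballI)
    fix x assume "x \<in> carrier G"
    then obtain k :: nat and y where y: "y \<in> carrier G" "x = w [^] k \<otimes> y" "\<not> p dvd ord y"
      using decomp by blast
    then obtain e where "y = (y [^] p) [^] (e::nat)"
      using root[OF y(1), of p] p by (auto simp: prime_imp_coprime)
    then have "y = (y [^] e) [^] p" using y by (simp add: nat_pow_pow mult.commute)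
    then show "\<exists>k::nat. \<exists>y\<in>carrier G. x = w [^] k \<otimes> y [^] p"
      using y by (intro exI[of _ k] bexI[of _ "y [^] e"]) auto
  qed
  then show "p \<notin> rank_primes G" using rank_primes_iff[OF p] by simp
  have "\<not> is_unit p" using p by auto
  then obtain m where m: "ord w = p ^ multiplicity p (ord w) * m" "\<not> p dvd m"
    using multiplicity_decompose'[of "ord w" p] torsion[OF w] by auto
  have "w [^] m \<in> primary_part G p"
    using w m by (auto simp: primary_part_def nat_pow_pow pow_eq_id mult.commute
        intro!: exI[of _ "multiplicity p (ord w)"])
  moreover have "\<exists>k::nat. x = (w [^] m) [^] k" if xP: "x \<in> primary_part G p" for x
  proof -
    obtain s where x: "x \<in> carrier G" "x [^] (p ^ s) = \<one>"
      using xP unfolding primary_part_def by blast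
    obtain k :: nat and y where y: "y \<in> carrier G" "x = w [^] k \<otimes> y" "\<not> p dvd ord y"
      using decomp[OF x(1)] by blast
    have xr: "x [^] ord y = w [^] (k * ord y)"
      using y w by (simp add: nat_pow_distrib nat_pow_pow)
    have "w [^] (k * ord y * p ^ s) = (x [^] (p ^ s)) [^] ord y"
      using w x xr by (metis nat_pow_pow mult.commute)
    then have "w [^] (k * ord y * p ^ s) = \<one>"
      using x by simp
    then have "m dvd k * ord y * p ^ s"
      using m(1) w by (metis dvd_mult_right pow_eq_id)
    moreover have "coprime m (p ^ s)"
      using m(2) p by (metis coprime_commute coprime_power_right_iff prime_imp_coprime)
    ultimately obtain l where l: "k * ord y = m * l"
      by (metis coprime_dvd_mult_left_iff dvdE)
    have "coprime (ord y) (p ^ s)"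
      using y(3) p by (metis coprime_commute coprime_power_right_iff prime_imp_coprime)
    then have "coprime (ord y) (ord x)"
      using x by (metis coprime_divisors dvd_refl pow_eq_id)
    then obtain e where "x = (x [^] ord y) [^] (e::nat)" using root[OF x(1)] by blast
    then have "x = (w [^] m) [^] (l * e)"
      using xr l w by (simp add: nat_pow_pow mult.assoc)
    then show ?thesis ..
  qed
  ultimately show "primary_part_cyclic G p"
    unfolding primary_part_cyclic_def by blast
qed

section \<open>Coordinates on a direct sum of cyclic monoids\<close>

text \<open>A monoid isomorphic to a direct sum, seen from inside: \<open>coord x i\<close> is the coordinate of \<open>x\<close> at
\<open>i\<close>, and \<open>gen i\<close> is the element of \<open>M\<close> that has a generator of the \<open>i\<close>-th summand at \<open>i\<close> and
\<open>\<one>\<close> elsewhere. Orders and powers can then be taken in \<open>M\<close> instead of the various summands.\<close>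

locale cyclic_decomposition = monoid M for M :: "('a, 'b) monoid_scheme" (structure) +
  fixes I :: "'i set" and K :: "'i \<Rightarrow> ('c, 'd) monoid_scheme"
    and coord :: "'a \<Rightarrow> 'i \<Rightarrow> 'c" and gen :: "'i \<Rightarrow> 'a"
  assumes component_monoid: "i \<in> I \<Longrightarrow> monoid (K i)"
    and coord_mult: "x \<in> carrier M \<Longrightarrow> y \<in> carrier M \<Longrightarrow> i \<in> I \<Longrightarrow>
      coord (x \<otimes> y) i = coord x i \<otimes>\<^bsub>K i\<^esub> coord y i"
    and coord_one: "i \<in> I \<Longrightarrow> coord \<one> i = \<one>\<^bsub>K i\<^esub>"
    and coord_eqI: "x \<in> carrier M \<Longrightarrow> y \<in> carrier M \<Longrightarrow>
      (\<And>i. i \<in> I \<Longrightarrow> coord x i = coord y i) \<Longrightarrow> x = y"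
    and finite_support: "x \<in> carrier M \<Longrightarrow> finite {i \<in> I. coord x i \<noteq> \<one>\<^bsub>K i\<^esub>}"
    and gen_closed: "i \<in> I \<Longrightarrow> gen i \<in> carrier M"
    and coord_gen_other: "i \<in> I \<Longrightarrow> j \<in> I \<Longrightarrow> j \<noteq> i \<Longrightarrow> coord (gen i) j = \<one>\<^bsub>K j\<^esub>"
    and coord_generated: "x \<in> carrier M \<Longrightarrow> i \<in> I \<Longrightarrow> \<exists>n::nat. coord x i = coord (gen i [^] n) i"
begin

lemma coord_pow:
  assumes "x \<in> carrier M" "i \<in> I"
  shows "coord (x [^] (n::nat)) i = coord x i [^]\<^bsub>K i\<^esub> n"
  using assms by (induction n) (simp_all add: coord_one coord_mult)

lemma coord_gen_pow_other:
  assumes "i \<in> I" "j \<in> I" "j \<noteq> i"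
  shows "coord (gen i [^] (n::nat)) j = \<one>\<^bsub>K j\<^esub>"
  using assms by (simp add: coord_pow gen_closed coord_gen_other component_monoid monoid.nat_pow_one)

lemma coord_gen_pow_eq_iff:
  assumes "i \<in> I"
  shows "coord (gen i [^] (m::nat)) i = coord (gen i [^] (n::nat)) i \<longleftrightarrow> gen i [^] m = gen i [^] n"
proof
  assume *: "coord (gen i [^] m) i = coord (gen i [^] n) i"
  show "gen i [^] m = gen i [^] n"
  proof (rule coord_eqI)
    fix j assume "j \<in> I"
    then show "coord (gen i [^] m) j = coord (gen i [^] n) j"
      using * assms by (cases "j = i") (simp_all add: coord_gen_pow_other)
  qed (use assms in \<open>simp_all add: gen_closed\<close>)
qed simp

lemma coord_gen_pow_eq_one_iff:
  assumes "i \<in> I"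
  shows "coord (gen i [^] (m::nat)) i = \<one>\<^bsub>K i\<^esub> \<longleftrightarrow> gen i [^] m = \<one>"
  using coord_gen_pow_eq_iff[OF assms, of m 0] assms by (simp add: coord_one)

lemma commutative:
  assumes "x \<in> carrier M" "y \<in> carrier M"
  shows "x \<otimes> y = y \<otimes> x"
proof (rule coord_eqI)
  fix i assume i: "i \<in> I"
  obtain m n :: nat where mn: "coord x i = coord (gen i [^] m) i" "coord y i = coord (gen i [^] n) i"
    using coord_generated assms i by metis
  have "coord (x \<otimes> y) i = coord (gen i [^] (m + n)) i"
    using assms i mn by (simp add: coord_mult gen_closed flip: nat_pow_mult)
  moreover have "coord (y \<otimes> x) i = coord (gen i [^] (n + m)) i"
    using assms i mn by (simp add: coord_mult gen_closed flip: nat_pow_mult)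
  ultimately show "coord (x \<otimes> y) i = coord (y \<otimes> x) i"
    by (simp add: add.commute)
qed (use assms in simp_all)

text \<open>Positive \<open>N i\<close> show that \<open>M\<close> is a torsion group. If \<open>M\<close> is a group and \<open>N i\<close> is the order of
\<open>gen i\<close>, this shows that only primes dividing the orders of the summands in its support can divide
the order of \<open>x\<close>.\<close>

lemma pow_support_prod_eq_one:
  assumes x: "x \<in> carrier M"
    and ann: "\<And>i. i \<in> I \<Longrightarrow> coord x i \<noteq> \<one>\<^bsub>K i\<^esub> \<Longrightarrow> gen i [^] (N i :: nat) = \<one>"
  shows "x [^] (\<Prod>i\<in>{i \<in> I. coord x i \<noteq> \<one>\<^bsub>K i\<^esub>}. N i) = \<one>"
proof (rule coord_eqI)
  let ?S = "{i \<in> I. coord x i \<noteq> \<one>\<^bsub>K i\<^esub>}"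
  fix i assume i: "i \<in> I"
  interpret Ki: monoid "K i" by (rule component_monoid[OF i])
  show "coord (x [^] (\<Prod>i\<in>?S. N i)) i = coord \<one> i"
  proof (cases "coord x i = \<one>\<^bsub>K i\<^esub>")
    case True
    then show ?thesis using x i by (simp add: coord_pow coord_one)
  next
    case False
    then have "N i dvd (\<Prod>i\<in>?S. N i)"
      using i finite_support[OF x] by (intro dvd_prodI) auto
    then obtain k where k: "(\<Prod>i\<in>?S. N i) = N i * k" by blast
    obtain n :: nat where n: "coord x i = coord (gen i [^] n) i"
      using coord_generated x i by blast
    have "coord (x [^] (N i * k)) i = coord ((gen i [^] n) [^] (N i * k)) i"
      using x i by (simp add: coord_pow n gen_closed)
    also have "(gen i [^] n) [^] (N i * k) = (gen i [^] N i) [^] (k * n)"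
      using i by (simp add: nat_pow_pow gen_closed ac_simps)
    also have "\<dots> = \<one>" using ann[OF i False] by simp
    finally show ?thesis using k by simp
  qed
qed (use x in simp_all)

lemma torsion:
  assumes ann: "\<And>i. i \<in> I \<Longrightarrow> \<exists>n>0. gen i [^] (n::nat) = \<one>" and x: "x \<in> carrier M"
  shows "\<exists>n>0. x [^] (n::nat) = \<one>"
proof -
  obtain N where N: "\<And>i. i \<in> I \<Longrightarrow> 0 < N i" "\<And>i. i \<in> I \<Longrightarrow> gen i [^] (N i :: nat) = \<one>"
    using ann by metis
  have "0 < (\<Prod>i\<in>{i \<in> I. coord x i \<noteq> \<one>\<^bsub>K i\<^esub>}. N i)"
    using N(1) by (intro prod_pos) auto
  then show ?thesis
    using pow_support_prod_eq_one[OF x, of N] N(2) by blast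
qed

text \<open>The inverse of \<open>gen i\<close> has as \<open>i\<close>-th coordinate a power of the generator, which shows that \<open>gen i\<close>
has finite order. So \<open>M\<close> is a group only if it is a torsion group.\<close>

lemma comm_group_iff: "comm_group M \<longleftrightarrow> (\<forall>i\<in>I. \<exists>n>0. gen i [^] (n::nat) = \<one>)"
proof
  assume "comm_group M"
  then interpret comm_group M .
  show "\<forall>i\<in>I. \<exists>n>0. gen i [^] (n::nat) = \<one>"
  proof
    fix i assume i: "i \<in> I"
    obtain k :: nat where k: "coord (inv (gen i)) i = coord (gen i [^] k) i"
      using coord_generated[of "inv (gen i)" i] i by (auto simp: gen_closed)
    have "coord (gen i [^] Suc k) i = coord (inv (gen i) \<otimes> gen i) i"
      using i by (simp only: k coord_mult gen_closed inv_closed nat_pow_Suc nat_pow_closed)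
    also have "\<dots> = \<one>\<^bsub>K i\<^esub>" using i by (simp add: gen_closed coord_one)
    finally have "gen i [^] Suc k = \<one>"
      using coord_gen_pow_eq_one_iff[OF i] by blast
    then show "\<exists>n>0. gen i [^] (n::nat) = \<one>" by blast
  qed
next
  assume ann: "\<forall>i\<in>I. \<exists>n>0. gen i [^] (n::nat) = \<one>"
  have "\<exists>y\<in>carrier M. y \<otimes> x = \<one>" if x: "x \<in> carrier M" for x
  proof -
    obtain n where n: "0 < n" "x [^] (n::nat) = \<one>"
      using torsion[OF _ x] ann by blast
    then have "x [^] (n - 1) \<otimes> x = \<one>" by (cases n) simp_all
    then show ?thesis using x by blast
  qed
  then show "comm_group M"
    by (intro comm_groupI) (auto simp: m_assoc intro: commutative)
qed

text \<open>As \<open>M\<close> is not a group, some \<open>gen i\<close> has no trivial positive power. Then the \<open>i\<close>-th coordinate of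
a product is trivial only if those of both factors are, which makes both parts of the partition by
triviality of this coordinate submonoids, once \<open>\<one>\<close> is added to the second. A further nontrivial
summand, which exists as \<open>M\<close> is not cyclic, provides an element outside the second part.\<close>

lemma covered_by_two:
  assumes not_group: "\<not> comm_group M" and not_cyclic: "\<not> cyclic_monoid M"
  shows "\<exists>A B. submonoid_covering M {A, B}"
proof -
  obtain i where i: "i \<in> I" "\<And>n::nat. gen i [^] n = \<one> \<Longrightarrow> n = 0"
    using not_group by (auto simp: comm_group_iff)
  have "\<exists>j. j \<in> I \<and> j \<noteq> i \<and> gen j \<noteq> \<one>"
  proof (rule ccontr)
    assume "\<nexists>j. j \<in> I \<and> j \<noteq> i \<and> gen j \<noteq> \<one>"
    then have trivial: "gen j = \<one>" if "j \<in> I" "j \<noteq> i" for j using that by blast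
    have "\<exists>n::nat. x = gen i [^] n" if x: "x \<in> carrier M" for x
    proof -
      obtain n :: nat where n: "coord x i = coord (gen i [^] n) i"
        using coord_generated[OF x i(1)] by blast
      have "x = gen i [^] n"
      proof (rule coord_eqI[OF x])
        fix j assume jI: "j \<in> I"
        show "coord x j = coord (gen i [^] n) j"
        proof (cases "j = i")
          case False
          obtain m :: nat where "coord x j = coord (gen j [^] m) j"
            using coord_generated[OF x jI] by blast
          then show ?thesis
            using False jI i trivial[OF jI False] by (simp add: coord_one coord_gen_pow_other)
        qed (use n in simp)
      qed (use i in \<open>simp add: gen_closed\<close>)
      then show ?thesis ..
    qed
    then show False
      using not_cyclic gen_closed[OF i(1)] monoid_axioms unfolding cyclic_monoid_iff by blast
  qed
  then obtain j where j: "j \<in> I" "j \<noteq> i" "gen j \<noteq> \<one>" by blast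
  interpret Ki: monoid "K i" by (rule component_monoid[OF i(1)])
  have reduced: "coord x i = \<one>\<^bsub>K i\<^esub> \<and> coord y i = \<one>\<^bsub>K i\<^esub>"
    if x: "x \<in> carrier M" and y: "y \<in> carrier M" and xy: "coord (x \<otimes> y) i = \<one>\<^bsub>K i\<^esub>" for x y
  proof -
    obtain m n :: nat where mn: "coord x i = coord (gen i [^] m) i" "coord y i = coord (gen i [^] n) i"
      using coord_generated x y i by metis
    have "coord (gen i [^] (m + n)) i = \<one>\<^bsub>K i\<^esub>"
      using x y xy i mn by (simp add: coord_mult gen_closed flip: nat_pow_mult)
    then have "gen i [^] (m + n) = \<one>"
      using coord_gen_pow_eq_one_iff[OF i(1)] by blast
    from i(2)[OF this] show ?thesis using mn i by (simp add: coord_one)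
  qed
  let ?A = "{x \<in> carrier M. coord x i = \<one>\<^bsub>K i\<^esub>}"
  let ?B = "{x \<in> carrier M. coord x i \<noteq> \<one>\<^bsub>K i\<^esub>} \<union> {\<one>}"
  have "submonoid ?A M"
    by unfold_locales (use i in \<open>auto simp: coord_mult coord_one\<close>)
  moreover have "submonoid ?B M"
    by unfold_locales (use reduced in auto)
  moreover have "gen i \<notin> ?A"
    using i(2)[of 1] coord_gen_pow_eq_one_iff[OF i(1), of 1] i(1) by (auto simp: gen_closed)
  moreover have "gen j \<notin> ?B"
    using j i by (simp add: coord_gen_other)
  moreover have "\<Union>{?A, ?B} = carrier M" by auto
  ultimately have "submonoid_covering M {?A, ?B}"
    unfolding submonoid_covering_def using i j gen_closed by blast
  then show ?thesis by blast
qed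

lemma ord_pos:
  assumes "comm_group M" and x: "x \<in> carrier M"
  shows "0 < group.ord M x"
proof -
  interpret comm_group M by fact
  have "\<exists>n>0. x [^] (n::nat) = \<one>"
    using torsion[OF _ x] assms(1) by (simp add: comm_group_iff)
  then show ?thesis using x by (metis gr0I ord_eq_0)
qed

text \<open>The two cases correspond to whether \<open>p\<close> divides the orders of two different summands. The first
one provides both the upper bound \<open>p + 1\<close> for the covering number and the identification of the
primes that occur in \<open>finite_covering_bound\<close>; the second one excludes all other primes there.\<close>

lemma rank_prime_dichotomy:
  assumes "comm_group M" and p: "Factorial_Ring.prime p"
  shows "(p \<in> rank_primes M \<and> (\<exists>C. submonoid_covering M C \<and> finite C \<and> card C \<le> p + 1)) \<or>
    (p \<notin> rank_primes M \<and> primary_part_cyclic M p)"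
proof -
  interpret comm_group M by fact
  show ?thesis
  proof (cases "\<exists>i\<in>I. \<exists>j\<in>I. i \<noteq> j \<and> p dvd ord (gen i) \<and> p dvd ord (gen j)")
    case True
    then obtain i j where ij: "i \<in> I" "j \<in> I" "i \<noteq> j" "p dvd ord (gen i)" "p dvd ord (gen j)" by blast
    \<comment> \<open>a discrete logarithm, well defined modulo the order of \<open>gen i\<close> and hence modulo \<open>p\<close>\<close>
    define f where "f i x = int (SOME n::nat. coord x i = coord (gen i [^] n) i)" for i x
    have f: "coord x k = coord (gen k [^] nat (f k x)) k" "0 \<le> f k x"
      if "x \<in> carrier M" "k \<in> I" for x k
      using someI_ex[OF coord_generated[OF that]] by (simp_all add: f_def)
    have f_cong: "[f k x = int n] (mod int p)"
      if x: "x \<in> carrier M" and k: "k \<in> I" "p dvd ord (gen k)" and n: "coord x k = coord (gen k [^] n) k"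
      for x k n
    proof -
      have "gen k [^] nat (f k x) = gen k [^] n"
        using f[OF x k(1)] n coord_gen_pow_eq_iff[OF k(1)] by metis
      then have "gen k [^] f k x = gen k [^] int n"
        using f(2)[OF x k(1)] by (metis int_pow_int int_nat_eq)
      then have "int (ord (gen k)) dvd int n - f k x"
        using int_pow_eq[OF gen_closed[OF k(1)]] by blast
      moreover have "int p dvd int (ord (gen k))" using k(2) by simp
      ultimately show ?thesis
        by (metis cong_iff_dvd_diff cong_sym dvd_trans)
    qed
    have f_add: "[f k (x \<otimes> y) = f k x + f k y] (mod int p)"
      if k: "k \<in> I" "p dvd ord (gen k)" and xy: "x \<in> carrier M" "y \<in> carrier M" for k x y
    proof -
      have "coord (x \<otimes> y) k = coord (gen k [^] (nat (f k x) + nat (f k y))) k"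
        using f(1)[OF xy(1) k(1)] f(1)[OF xy(2) k(1)] xy k
        by (simp add: coord_mult gen_closed flip: nat_pow_mult)
      from f_cong[OF _ k this] show ?thesis
        using xy f(2) k by simp
    qed
    have f_gen: "[f k (gen k) = 1] (mod int p)" if k: "k \<in> I" "p dvd ord (gen k)" for k
      using f_cong[of "gen k" k 1] k by (simp add: gen_closed)
    have f_gen_other: "[f k (gen l) = 0] (mod int p)"
      if k: "k \<in> I" "p dvd ord (gen k)" and l: "l \<in> I" "l \<noteq> k" for k l
      using f_cong[of "gen l" k 0] k l by (simp add: gen_closed coord_gen_other coord_one)
    note chars = p f_add[OF ij(1,4)] f_add[OF ij(2,5)]
      gen_closed[OF ij(1)] f_gen[OF ij(1,4)] f_gen_other[OF ij(2,5,1,3)]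
      gen_closed[OF ij(2)] f_gen_other[OF ij(1,4,2) ij(3)[symmetric]] f_gen[OF ij(2,5)]
    show ?thesis
      using two_characters_rank_prime[OF chars] two_characters_covering[OF chars] by blast
  next
    case at_most_one: False
    have coprime_ord: "\<not> p dvd ord x"
      if x: "x \<in> carrier M" and supp: "\<And>i. i \<in> I \<Longrightarrow> coord x i \<noteq> \<one>\<^bsub>K i\<^esub> \<Longrightarrow> \<not> p dvd ord (gen i)" for x
    proof -
      let ?S = "{i \<in> I. coord x i \<noteq> \<one>\<^bsub>K i\<^esub>}"
      have "x [^] (\<Prod>i\<in>?S. ord (gen i)) = \<one>"
        by (rule pow_support_prod_eq_one[OF x]) (simp add: gen_closed)
      then have "ord x dvd (\<Prod>i\<in>?S. ord (gen i))" using x by (simp add: pow_eq_id)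
      moreover have "\<not> p dvd (\<Prod>i\<in>?S. ord (gen i))"
        using p supp finite_support[OF x] by (auto simp: prime_dvd_prod_iff)
      ultimately show ?thesis using dvd_trans by blast
    qed
    \<comment> \<open>\<open>w\<close> is the generator of the one summand whose order \<open>p\<close> divides, or \<open>\<one>\<close> without such a summand.\<close>
    obtain w where w: "w \<in> carrier M"
      "\<And>x. x \<in> carrier M \<Longrightarrow> \<exists>k::nat. \<exists>y\<in>carrier M. x = w [^] k \<otimes> y \<and> \<not> p dvd ord y"
    proof (cases "\<exists>i\<in>I. p dvd ord (gen i)")
      case True
      then obtain i where i: "i \<in> I" "p dvd ord (gen i)" by blast
      have "\<exists>k::nat. \<exists>y\<in>carrier M. x = gen i [^] k \<otimes> y \<and> \<not> p dvd ord y"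
        if x: "x \<in> carrier M" for x
      proof -
        obtain k :: nat where k: "coord x i = coord (gen i [^] k) i"
          using coord_generated[OF x i(1)] by blast
        let ?z = "gen i [^] k"
        let ?y = "inv ?z \<otimes> x"
        have z: "?z \<in> carrier M" using i by (simp add: gen_closed)
        have "coord ?y i = coord (inv ?z \<otimes> ?z) i"
          using i by (simp only: k coord_mult z x inv_closed)
        then have "coord ?y i = \<one>\<^bsub>K i\<^esub>" using z i by (simp add: coord_one)
        then have supp: "\<not> p dvd ord (gen j)" if "j \<in> I" "coord ?y j \<noteq> \<one>\<^bsub>K j\<^esub>" for j
          using at_most_one i that by metis
        have "\<not> p dvd ord ?y"
          by (rule coprime_ord[OF _ supp]) (use x z in simp_all)
        moreover have "x = ?z \<otimes> ?y"
          using inv_solve_left[OF _ z x, of ?y] x z by simp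
        ultimately show ?thesis using x z by blast
      qed
      then show thesis using that[OF gen_closed[OF i(1)]] by blast
    next
      case False
      have "\<exists>k::nat. \<exists>y\<in>carrier M. x = \<one> [^] k \<otimes> y \<and> \<not> p dvd ord y" if x: "x \<in> carrier M" for x
        using x coprime_ord[OF x] False by (intro exI[of _ 0] bexI[of _ x]) auto
      then show thesis using that[OF one_closed] by blast
    qed
    show ?thesis
      using cyclic_up_to_coprime_order_primary[OF p ord_pos[OF assms(1)] w] cyclic_up_to_coprime_order_rank[OF p ord_pos[OF assms(1)] w]
      by blast
  qed
qed

end

lemma cyclic_decomposition_exists:
  fixes M :: "('a, 'b) monoid_scheme" and I :: "'i set" and K :: "'i \<Rightarrow> ('c, 'd) monoid_scheme"
  assumes M: "monoid M" and cyc: "\<And>i. i \<in> I \<Longrightarrow> cyclic_monoid (K i)"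
    and iso: "M \<cong> direct_sum_monoid I K"
  obtains coord gen where "cyclic_decomposition M I K coord gen"
proof -
  let ?D = "direct_sum_monoid I K"
  interpret monoid M by fact
  obtain h where h: "h \<in> hom M ?D" "bij_betw h (carrier M) (carrier ?D)"
    using iso by (auto simp: is_iso_def iso_def)
  have K: "monoid (K i)" if "i \<in> I" for i
    using cyc[OF that] by (simp add: cyclic_monoid_def)
  obtain a where a: "\<And>i. i \<in> I \<Longrightarrow> a i \<in> carrier (K i)"
    "\<And>i b. i \<in> I \<Longrightarrow> b \<in> carrier (K i) \<Longrightarrow> \<exists>n::nat. b = a i [^]\<^bsub>K i\<^esub> n"
    using cyc unfolding cyclic_monoid_iff by metis
  have D: "carrier ?D = {x \<in> Pi\<^sub>E I (\<lambda>i. carrier (K i)). finite {i \<in> I. x i \<noteq> \<one>\<^bsub>K i\<^esub>}}"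
    by (simp add: direct_sum_monoid_def)
  have hD: "h x \<in> carrier ?D" if "x \<in> carrier M" for x
    using h(1) that by (auto simp: hom_def)
  have mult: "h (x \<otimes>\<^bsub>M\<^esub> y) i = h x i \<otimes>\<^bsub>K i\<^esub> h y i" if "x \<in> carrier M" "y \<in> carrier M" "i \<in> I" for x y i
    using hom_mult[OF h(1) that(1,2)] that(3) by (simp add: direct_sum_monoid_def)
  have closed: "h x i \<in> carrier (K i)" if "x \<in> carrier M" "i \<in> I" for x i
    using hD[OF that(1)] that(2) by (auto simp: D)
  have onto: "\<exists>x\<in>carrier M. h x = d" if "d \<in> carrier ?D" for d
    using h(2) that by (metis bij_betw_imp_surj_on imageE)
  \<comment> \<open>Homomorphisms of monoids only respect products here; \<open>h\<close> respects \<open>\<one>\<close> as it is onto.\<close>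
  have one: "h \<one>\<^bsub>M\<^esub> i = \<one>\<^bsub>K i\<^esub>" if i: "i \<in> I" for i
  proof -
    interpret Ki: monoid "K i" by (rule K[OF i])
    have "(\<lambda>i\<in>I. \<one>\<^bsub>K i\<^esub>) \<in> carrier ?D"
      using K by (auto simp: D monoid.one_closed)
    then obtain z where z: "z \<in> carrier M" "h z = (\<lambda>i\<in>I. \<one>\<^bsub>K i\<^esub>)" using onto by blast
    show ?thesis
      using mult[OF one_closed z(1) i] z i closed[OF one_closed i] by simp
  qed
  have "\<exists>x\<in>carrier M. h x = (\<lambda>j\<in>I. if j = i then a i else \<one>\<^bsub>K j\<^esub>)" if i: "i \<in> I" for i
  proof (rule onto)
    have "{j \<in> I. (\<lambda>j\<in>I. if j = i then a i else \<one>\<^bsub>K j\<^esub>) j \<noteq> \<one>\<^bsub>K j\<^esub>} \<subseteq> {i}" by auto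
    then have "finite {j \<in> I. (\<lambda>j\<in>I. if j = i then a i else \<one>\<^bsub>K j\<^esub>) j \<noteq> \<one>\<^bsub>K j\<^esub>}"
      by (rule finite_subset) simp
    then show "(\<lambda>j\<in>I. if j = i then a i else \<one>\<^bsub>K j\<^esub>) \<in> carrier ?D"
      using a(1) K by (auto simp: D monoid.one_closed)
  qed
  then obtain gen where gen: "\<And>i. i \<in> I \<Longrightarrow> gen i \<in> carrier M"
    "\<And>i. i \<in> I \<Longrightarrow> h (gen i) = (\<lambda>j\<in>I. if j = i then a i else \<one>\<^bsub>K j\<^esub>)"
    by metis
  have "cyclic_decomposition M I K h gen"
  proof
    show "x = y" if "x \<in> carrier M" "y \<in> carrier M" "\<And>i. i \<in> I \<Longrightarrow> h x i = h y i" for x y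
    proof -
      have "h x = h y"
        using hD[OF that(1)] hD[OF that(2)] that(3) by (auto simp: D intro: PiE_ext)
      then show ?thesis
        using h(2) that(1,2) by (meson bij_betw_imp_inj_on inj_onD)
    qed
    show "finite {i \<in> I. h x i \<noteq> \<one>\<^bsub>K i\<^esub>}" if "x \<in> carrier M" for x
      using hD[OF that] by (simp add: D)
    show "\<exists>n::nat. h x i = h (gen i [^]\<^bsub>M\<^esub> n) i" if x: "x \<in> carrier M" and i: "i \<in> I" for x i
    proof -
      have "h (gen i [^]\<^bsub>M\<^esub> n) i = a i [^]\<^bsub>K i\<^esub> n" for n :: nat
        using i by (induction n) (simp_all add: gen one mult)
      then show ?thesis using a(2)[OF i closed[OF x i]] by simp
    qed
  qed (use K closed mult one gen in \<open>simp_all add: monoid.m_closed monoid.m_assoc\<close>)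
  then show thesis by (rule that)
qed

section \<open>Covering numbers\<close>

lemma card_of_eqI_finite:
  "finite A \<Longrightarrow> finite B \<Longrightarrow> card A = card B \<Longrightarrow> |A| =o |B|"
  using card_of_ordIso finite_same_card_bij by blast

lemma submonoid_covering_card_gt_1:
  assumes "monoid M" "submonoid_covering M C" "finite C"
  shows "2 \<le> card C"
proof (rule ccontr)
  assume "\<not> 2 \<le> card C"
  then consider "card C = 0" | "card C = 1" by linarith
  then show False
  proof cases
    case 1
    then show ?thesis
      using assms monoid.one_closed by (auto simp: submonoid_covering_def)
  next
    case 2
    then obtain H where "C = {H}" using card_1_singletonE by blast
    then show ?thesis using assms(2) by (auto simp: submonoid_covering_def)
  qed
qed

lemma covering_number_finite:
  assumes C: "submonoid_covering M C" "finite C" "card C \<le> n"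
    and bound: "\<And>D. submonoid_covering M D \<Longrightarrow> finite D \<Longrightarrow> n \<le> card D"
  shows "covering_number M =o |{..<n}|"
proof -
  have cov: "coverable M" using C by (auto simp: coverable_def)
  obtain D where D: "submonoid_covering M D" "covering_number M = |D|"
    using covering_number_least(1)[OF cov] by blast
  have "|D| \<le>o |C|" using covering_number_least(2)[OF cov C(1)] D(2) by simp
  then obtain f where f: "inj_on f D" "f ` D \<subseteq> C"
    using card_of_ordLeq by metis
  then have "finite D" using C(2) inj_on_finite by blast
  moreover have "card D = n"
    using card_inj_on_le[OF f C(2)] C(3) bound[OF D(1)] \<open>finite D\<close> by linarith
  ultimately show ?thesis
    unfolding D(2) by (intro card_of_eqI_finite) auto
qed

text \<open>A finite covering has at least \<open>p + 1\<close> members for some \<open>p \<in> rank_primes G\<close>, so the covering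
given for the least such \<open>p\<close> is optimal. Without such primes every covering is infinite, and the
subgroups of elements killed by \<open>n > 0\<close> form a countable one.\<close>

lemma (in comm_group) covering_number_torsion_group:
  assumes torsion: "\<And>x. x \<in> carrier G \<Longrightarrow> 0 < ord x"
    and not_cyclic: "\<not> cyclic_monoid G"
    and dichotomy: "\<And>p. Factorial_Ring.prime p \<Longrightarrow>
      (p \<in> rank_primes G \<and> (\<exists>C. submonoid_covering G C \<and> finite C \<and> card C \<le> p + 1)) \<or>
      (p \<notin> rank_primes G \<and> primary_part_cyclic G p)"
  shows "coverable G \<and> (rank_primes G = {} \<and> covering_number G =o |UNIV :: int set| \<or>
    rank_primes G \<noteq> {} \<and> |{..<3 :: nat}| \<le>o covering_number G \<and>
      covering_number G <o natLeq \<and> covering_number G =o |{..<nu_prime G}| )"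
proof -
  have bound: "\<exists>p\<in>rank_primes G. p + 1 \<le> card C"
    if C: "submonoid_covering G C" "finite C" for C
  proof -
    have "subgroup H G \<and> H \<noteq> carrier G" if "H \<in> C" for H
      using C(1) that submonoid_is_subgroup[OF torsion] by (auto simp: submonoid_covering_def)
    moreover have "carrier G \<subseteq> \<Union>C" using C(1) by (simp add: submonoid_covering_def)
    ultimately obtain p where "Factorial_Ring.prime p" "\<not> primary_part_cyclic G p" "p + 1 \<le> card C"
      using finite_covering_bound[OF torsion C(2)] by blast
    then show ?thesis using dichotomy by blast
  qed
  show ?thesis
  proof (cases "rank_primes G = {}")
    case True
    let ?H = "\<lambda>n. {x \<in> carrier G. x [^] (n::nat) = \<one>}"
    let ?C = "?H ` {0<..}"
    have "submonoid (?H n) G" for n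
      by unfold_locales (auto simp: nat_pow_distrib)
    moreover have "?H n \<noteq> carrier G" if "0 < n" for n
      using cyclic_if_bounded_exponent[OF that] dichotomy True not_cyclic by blast
    moreover have "\<Union>?C = carrier G"
      using torsion pow_ord_eq_1 by blast
    ultimately have C: "submonoid_covering G ?C"
      unfolding submonoid_covering_def by blast
    then have cov: "coverable G" by (auto simp: coverable_def)
    have "|?C| \<le>o |UNIV :: nat set|"
      by (rule ordLeq_transitive[OF card_of_image card_of_mono1[OF subset_UNIV]])
    with covering_number_least(2)[OF cov C] have upper: "covering_number G \<le>o |UNIV :: nat set|"
      by (rule ordLeq_transitive)
    obtain D where D: "submonoid_covering G D" "covering_number G = |D|"
      using covering_number_least(1)[OF cov] by blast
    have "infinite D" using bound[OF D(1)] True by blast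
    then have "|UNIV :: nat set| \<le>o covering_number G"
      unfolding D(2) by (simp add: infinite_iff_card_of_nat[symmetric])
    with upper have "covering_number G =o |UNIV :: nat set|"
      by (simp add: ordIso_iff_ordLeq)
    moreover have "|UNIV :: nat set| =o |UNIV :: int set|"
      by (rule card_of_ordIsoI[OF bij_int_decode])
    ultimately have "covering_number G =o |UNIV :: int set|"
      by (rule ordIso_transitive)
    then show ?thesis using cov True by simp
  next
    case False
    have "\<exists>n. \<exists>p\<in>rank_primes G. n = p + 1" using False by blast
    then have "\<exists>p\<in>rank_primes G. nu_prime G = p + 1"
      unfolding nu_prime_def by (rule LeastI_ex)
    then obtain p where p: "p \<in> rank_primes G" "nu_prime G = p + 1" by blast
    have prime: "Factorial_Ring.prime p" using p(1) by (simp add: rank_primes_def)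
    have least: "nu_prime G \<le> q + 1" if "q \<in> rank_primes G" for q
      unfolding nu_prime_def using that by (intro Least_le) blast
    obtain C where C: "submonoid_covering G C" "finite C" "card C \<le> nu_prime G"
      using dichotomy[OF prime] p by auto
    have eq: "covering_number G =o |{..<nu_prime G}|"
    proof (rule covering_number_finite[OF C])
      fix D assume "submonoid_covering G D" "finite D"
      then obtain q where "q \<in> rank_primes G" "q + 1 \<le> card D" using bound by blast
      then show "nu_prime G \<le> card D" using least[of q] by linarith
    qed
    moreover have "|{..<3 :: nat}| \<le>o |{..<nu_prime G}|"
      using prime_ge_2_nat[OF prime] p(2) by (intro card_of_mono1) auto
    then have "|{..<3 :: nat}| \<le>o covering_number G"
      by (rule ordLeq_ordIso_trans[OF _ ordIso_symmetric[OF eq]])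
    moreover have "|{..<nu_prime G}| <o natLeq"
      using finite_iff_ordLess_natLeq[of "{..<nu_prime G}"] by simp
    then have "covering_number G <o natLeq"
      by (rule ordIso_ordLess_trans[OF eq])
    moreover have "coverable G" using C by (auto simp: coverable_def)
    ultimately show ?thesis using False by simp
  qed
qed

theorem theorem3p6:
  fixes M :: "('a, 'b) monoid_scheme"
    and I :: "'i set"
    and K :: "'i \<Rightarrow> ('c, 'd) monoid_scheme"
  assumes "monoid M"
    and "\<And>i. i \<in> I \<Longrightarrow> cyclic_monoid (K i)"
    and "M \<cong> direct_sum_monoid I K"
  shows "let
      case1 = cyclic_monoid M \<and> \<not> coverable M;
      case2 = comm_group M \<and> \<not> cyclic_monoid M \<and> coverable M \<and>
        (rank_primes M = {} \<and> covering_number M =o |UNIV :: int set| \<or>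
         rank_primes M \<noteq> {} \<and>
           |{..<3 :: nat}| \<le>o covering_number M \<and> covering_number M <o natLeq \<and>
           covering_number M =o |{..<nu_prime M}| );
      case3 = \<not> cyclic_monoid M \<and> \<not> comm_group M \<and> coverable M \<and>
        covering_number M =o |{..<2 :: nat}|
    in (case1 \<or> case2 \<or> case3) \<and>
      \<not> (case1 \<and> case2) \<and> \<not> (case1 \<and> case3) \<and> \<not> (case2 \<and> case3)"
proof -
  obtain coord gen where "cyclic_decomposition M I K coord gen"
    using cyclic_decomposition_exists assms by metis
  then interpret M: cyclic_decomposition M I K coord gen .
  have group_case: "coverable M \<and> (rank_primes M = {} \<and> covering_number M =o |UNIV :: int set| \<or>
      rank_primes M \<noteq> {} \<and> |{..<3 :: nat}| \<le>o covering_number M \<and>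
        covering_number M <o natLeq \<and> covering_number M =o |{..<nu_prime M}| )"
    if "comm_group M" "\<not> cyclic_monoid M"
    using that by (intro comm_group.covering_number_torsion_group M.ord_pos M.rank_prime_dichotomy)
  have other_case: "coverable M \<and> covering_number M =o |{..<2 :: nat}|"
    if nongroup: "\<not> comm_group M" "\<not> cyclic_monoid M"
  proof -
    obtain A B where AB: "submonoid_covering M {A, B}"
      using M.covered_by_two[OF nongroup] by blast
    have "covering_number M =o |{..<2 :: nat}|"
      by (rule covering_number_finite[OF AB])
        (use submonoid_covering_card_gt_1[OF assms(1)] in \<open>auto simp: card_insert_if\<close>)
    then show ?thesis using AB by (auto simp: coverable_def)
  qed
  show ?thesis
    unfolding Let_def using cyclic_monoid_not_coverable[of M] group_case other_case by blast
qed

end
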